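(* Let $k>1$ be an integer. The set of somewhere differentiable functions is thick in $C([0,1]^k)$; that is, for every compact set $K\subseteq C([0,1]^k)$ there is a function $g\in C([0,1]^k)$ such that every element of $K+g$ is somewhere differentiable.
   Context: $C([0,1]^k)$ is the space of continuous functions $f\colon[0,1]^k\to\mathbb{R}$ with the supremum norm, regarded as an abelian Polish group under addition. A function $f\in C([0,1]^k)$ is nowhere differentiable if it does not have a finite directional derivative at any point along any nonzero vector; at points of the boundary of $[0,1]^k$ it is required that there is no finite one-sided directional derivative along any nonzero vector (pointing into the cube). A function $f\in C([0,1]^k)$ is somewhere differentiable if it is not nowhere differentiable. A subset $A$ of an abelian Polish group $X$ is called thick if for every compact set $K\subseteq X$ there is $x\in X$ with $K+x\subseteq A$. *)

theory Defs
  imports "HOL-Analysis.Analysis"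
begin

typedef ('n::finite) unit_cube = "cbox 0 1 :: (real ^ 'n) set"
  morphisms point_of to_cube
  by (rule exI[of _ 0]) (simp add: mem_box_cart)

instantiation unit_cube :: (finite) metric_space
begin

definition dist_unit_cube :: "'a unit_cube \<Rightarrow> 'a unit_cube \<Rightarrow> real" where
  "dist_unit_cube x y = dist (point_of x) (point_of y)"

definition uniformity_unit_cube :: "('a unit_cube \<times> 'a unit_cube) filter" where
  "uniformity_unit_cube = (INF e\<in>{0 <..}. principal {(x, y). dist x y < e})"

definition open_unit_cube :: "'a unit_cube set \<Rightarrow> bool" where
  "open_unit_cube U \<longleftrightarrow> (\<forall>x\<in>U. eventually (\<lambda>(x', y). x' = x \<longrightarrow> y \<in> U) uniformity)"

instance
proof
  fix x y z :: "'a unit_cube"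
  show "dist x y = 0 \<longleftrightarrow> x = y"
    by (simp add: dist_unit_cube_def point_of_inject)
  show "dist x y \<le> dist x z + dist y z"
    unfolding dist_unit_cube_def by (rule dist_triangle2)
qed (simp_all add: uniformity_unit_cube_def open_unit_cube_def)

end

lemma continuous_on_point_of: "continuous_on UNIV point_of"
  unfolding continuous_on_iff dist_unit_cube_def by auto

lemma continuous_on_to_cube: "continuous_on (cbox 0 1) to_cube"
  unfolding continuous_on_iff dist_unit_cube_def by (auto simp: to_cube_inverse)

lemma compact_UNIV_unit_cube: "compact (UNIV :: 'n::finite unit_cube set)"
proof -
  have "to_cube ` cbox 0 1 = (UNIV :: 'n unit_cube set)"
    by (metis point_of point_of_inverse image_eqI subsetI subset_antisym subset_UNIV)
  then show ?thesis
    using compact_continuous_image[OF continuous_on_to_cube compact_cbox] by metis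
qed

text \<open>
  The space of continuous real functions on the cube, with pointwise addition and the supremum
  norm, is the library type of bounded continuous functions on the cube: boundedness is automatic.
\<close>

lemma continuous_on_unit_cube_bcontfun:
  fixes f :: "'n::finite unit_cube \<Rightarrow> real"
  shows "f \<in> bcontfun \<longleftrightarrow> continuous_on UNIV f"
  using compact_imp_bounded[OF compact_continuous_image[OF _ compact_UNIV_unit_cube], of f]
  by (auto simp: bcontfun_def)

text \<open>
  The value of \<open>to_cube\<close> outside the cube is arbitrary. It is irrelevant for
  two-sided limits at interior points, and for one-sided limits along vectors pointing into the cube.
\<close>

definition has_directional_derivative ::
    "('n::finite unit_cube \<Rightarrow>\<^sub>C real) \<Rightarrow> 'n unit_cube \<Rightarrow> real ^ 'n \<Rightarrow> real \<Rightarrow> bool" where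
  "has_directional_derivative f x v d \<longleftrightarrow>
     ((\<lambda>t. (f (to_cube (point_of x + t *\<^sub>R v)) - f x) / t) \<longlongrightarrow> d) (at 0)"

definition has_one_sided_directional_derivative ::
    "('n::finite unit_cube \<Rightarrow>\<^sub>C real) \<Rightarrow> 'n unit_cube \<Rightarrow> real ^ 'n \<Rightarrow> real \<Rightarrow> bool" where
  "has_one_sided_directional_derivative f x v d \<longleftrightarrow>
     ((\<lambda>t. (f (to_cube (point_of x + t *\<^sub>R v)) - f x) / t) \<longlongrightarrow> d) (at_right 0)"

text \<open>Vectors tangent to a face at a boundary point count as pointing into the cube as long as they
  do not leave it.\<close>

definition points_into_cube :: "'n::finite unit_cube \<Rightarrow> real ^ 'n \<Rightarrow> bool" where
  "points_into_cube x v \<longleftrightarrow> (\<forall>\<^sub>F t in at_right 0. point_of x + t *\<^sub>R v \<in> cbox 0 1)"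

definition nowhere_differentiable :: "('n::finite unit_cube \<Rightarrow>\<^sub>C real) \<Rightarrow> bool" where
  "nowhere_differentiable f \<longleftrightarrow>
     (\<forall>x v. point_of x \<in> interior (cbox 0 1) \<and> v \<noteq> 0 \<longrightarrow>
        \<not> (\<exists>d. has_directional_derivative f x v d)) \<and>
     (\<forall>x v. point_of x \<in> frontier (cbox 0 1) \<and> v \<noteq> 0 \<and> points_into_cube x v \<longrightarrow>
        \<not> (\<exists>d. has_one_sided_directional_derivative f x v d))"

definition somewhere_differentiable :: "('n::finite unit_cube \<Rightarrow>\<^sub>C real) \<Rightarrow> bool" where
  "somewhere_differentiable f \<longleftrightarrow> \<not> nowhere_differentiable f"

text \<open>Intended for abelian Polish groups; the definition only needs the group and the topology.\<close>

definition thick :: "'a::{ab_group_add, topological_space} set \<Rightarrow> bool" where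
  "thick A \<longleftrightarrow> (\<forall>K. compact K \<longrightarrow> (\<exists>x. (\<lambda>y. y + x) ` K \<subseteq> A))"

end

theory Submission
  imports Defs
begin

text \<open>
  A compact set \<open>K\<close> of functions on a cube of dimension at least two can be laid out along one
  coordinate axis. Every compact metric space is a continuous image \<open>\<phi> ` S\<close> of a compact set \<open>S\<close> of
  reals (\<open>compact_metric_image_of_compact_reals\<close>). Fix a coordinate \<open>j\<close>, and reserve the slice of
  the cube whose \<open>j\<close>-th coordinate is \<open>(t + 1) / 3\<close> for the function \<open>\<phi> t\<close>: on that slice let
  \<open>g = - \<phi> t\<close>. Since \<open>\<phi>\<close> is continuous and evaluation is jointly continuous, this prescribes a
  continuous function on the closed union of the reserved slices, which the Tietze--Dugundji theorem
  extends to the whole cube. Now \<open>\<phi> t + g\<close> vanishes identically on its slice. Another coordinate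
  direction \<open>i \<noteq> j\<close> is available, and a line in that direction stays inside the slice, so at an
  interior point the directional derivative of \<open>\<phi> t + g\<close> along it exists and is zero.

  The map \<open>\<phi>\<close> is obtained by coding a point of \<open>K\<close> by the countably many answers to the questions
  whether it lies in a given ball, the balls ranging over finite nets of all scales. The answers are
  stored as the base four digits of a real \<open>t\<close>, with only the digits 0 and 2 in use. The gaps
  that this leaves make it possible to read a digit off \<open>t\<close> by closed conditions
  (\<open>cos_quaternary\<close>). The relation between codes and coded points is then compact, and a compact
  graph belongs to a continuous function.
\<close>

text \<open>The point of a Cantor set whose base four digits are 0 and 2 according to \<open>b\<close>.\<close>

definition quaternary :: "(nat \<Rightarrow> bool) \<Rightarrow> real" where
  "quaternary b = (\<Sum>j. 2 * of_bool (b j) / 4 ^ Suc j)"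

lemma summable_quaternary: "summable (\<lambda>j. 2 * of_bool (b j) / 4 ^ Suc j :: real)"
proof (rule summable_comparison_test')
  show "summable (\<lambda>j. 2 / 4 * (1 / 4) ^ j :: real)"
    by (intro summable_mult summable_geometric) auto
qed (auto simp: power_divide)

lemma quaternary_bounds: "0 \<le> quaternary b" "quaternary b \<le> 2 / 3"
proof -
  show "0 \<le> quaternary b"
    unfolding quaternary_def by (intro suminf_nonneg summable_quaternary) auto
  have s: "(\<lambda>j. 2 / 4 * (1 / 4) ^ j :: real) sums (2 / 4 * (1 / (1 - 1 / 4)))"
    by (intro sums_mult geometric_sums) auto
  have "quaternary b \<le> (\<Sum>j. 2 / 4 * (1 / 4) ^ j :: real)"
    unfolding quaternary_def
    by (intro suminf_le summable_quaternary sums_summable[OF s]) (auto simp: power_divide)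
  also have "\<dots> = 2 / 3"
    using sums_unique[OF s] by simp
  finally show "quaternary b \<le> 2 / 3" .
qed

lemma quaternary_shift: "quaternary b = of_bool (b 0) / 2 + quaternary (\<lambda>j. b (Suc j)) / 4"
  unfolding quaternary_def
  using suminf_split_head[OF summable_quaternary, of b]
    suminf_divide[OF summable_quaternary, of "\<lambda>j. b (Suc j)" 4]
  by (simp add: field_simps)

text \<open>Multiplying by \<open>4 ^ m\<close> moves the first \<open>m\<close> digits in front of the point, so that a function
  of period one sees only the remaining ones.\<close>

lemma quaternary_scale:
  "\<exists>n::int. 4 ^ m * quaternary b = of_int n + quaternary (\<lambda>j. b (m + j))"
proof (induction m)
  case 0
  show ?case by (auto intro: exI[of _ 0])
next
  case (Suc m)
  then obtain n :: int where n: "4 ^ m * quaternary b = of_int n + quaternary (\<lambda>j. b (m + j))"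
    by blast
  have "4 ^ Suc m * quaternary b = 4 * (4 ^ m * quaternary b)"
    by simp
  also have "\<dots> = of_int (4 * n + 2 * of_bool (b m)) + quaternary (\<lambda>j. b (Suc m + j))"
    unfolding n using quaternary_shift[of "\<lambda>j. b (m + j)"] by simp
  finally show ?case by blast
qed

text \<open>
  Up to an integer, \<open>4 ^ m * quaternary b\<close> lies in \<open>[0, 1/6]\<close> if the digit \<open>b m\<close> is 0, and in
  \<open>[1/2, 2/3]\<close> if it is 2. The cosine separates these two cases by a gap, as in Schoenberg's
  construction of a space-filling curve.
\<close>

lemma cos_quaternary:
  "if b m then cos (2 * pi * (4 ^ m * quaternary b)) \<le> - 1 / 2
   else cos (2 * pi * (4 ^ m * quaternary b)) \<ge> 1 / 2"
proof -
  define s where "s = quaternary (\<lambda>j. b (Suc m + j)) / 4"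
  have s: "0 \<le> s" "s \<le> 1 / 6"
    using quaternary_bounds[of "\<lambda>j. b (Suc m + j)"] by (auto simp: s_def)
  obtain n :: int where n: "4 ^ m * quaternary b = of_int n + quaternary (\<lambda>j. b (m + j))"
    using quaternary_scale by blast
  have "4 ^ m * quaternary b = of_int n + (of_bool (b m) / 2 + s)"
    unfolding n using quaternary_shift[of "\<lambda>j. b (m + j)"] by (simp add: s_def)
  then have "cos (2 * pi * (4 ^ m * quaternary b)) = cos (2 * pi * of_int n + (of_bool (b m) * pi + 2 * pi * s))"
    by (simp add: algebra_simps)
  also have "\<dots> = cos (of_bool (b m) * pi + 2 * pi * s)"
    by (simp add: cos_add)
  finally have eq: "cos (2 * pi * (4 ^ m * quaternary b)) = (if b m then - cos (2 * pi * s) else cos (2 * pi * s))"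
    by (simp add: add.commute)
  have "cos (pi / 3) \<le> cos (2 * pi * s)"
    using s by (intro cos_monotone_0_pi_le) (auto simp: field_simps)
  then show ?thesis
    unfolding eq by (auto simp: cos_60)
qed

text \<open>
  This is the Alexandroff--Hausdorff theorem with its Cantor set cut down to a compact subset. The
  relation \<open>R\<close> below consists of the pairs of a code and a point coded by it. Boundary points of a
  ball may be coded either way; this freedom makes \<open>R\<close> closed, and it does not spoil
  uniqueness, since two distinct points are separated by a ball of small enough radius.
\<close>

lemma compact_metric_image_of_compact_reals:
  fixes K :: "'a::metric_space set"
  assumes "compact K"
  obtains S :: "real set" and \<phi> where "compact S" "S \<subseteq> {0..1}" "continuous_on S \<phi>" "\<phi> ` S = K"
proof -
  have "\<exists>A. finite A \<and> K \<subseteq> (\<Union>a\<in>A. ball a (1 / Suc n))" for n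
    using assms by (simp add: compact_eq_totally_bounded)
  then obtain A where A: "\<And>n. finite (A n)" "\<And>n. K \<subseteq> (\<Union>a\<in>A n. ball a (1 / Suc n))"
    by metis
  define P where "P = (SIGMA n:UNIV. A n)"
  have "countable P"
    unfolding P_def using A(1) by (intro countable_SIGMA) (auto intro: countable_finite)
  define idx where "idx = to_nat_on P"
  define c where "c p t = cos (2 * pi * (4 ^ idx p * t))" for p and t :: real
  define R where "R = ({0..1} \<times> K) \<inter> (\<Inter>p\<in>P.
      ({(t, f). c p t \<le> - 1 / 2} \<inter> {(t, f). dist (snd p) f \<le> 1 / Suc (fst p)}) \<union>
      ({(t, f). c p t \<ge> 1 / 2} \<inter> {(t, f). dist (snd p) f \<ge> 1 / Suc (fst p)}))"
  have "compact R"
    unfolding R_def c_def case_prod_beta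
    by (intro compact_Int_closed compact_Times assms compact_Icc closed_INT ballI closed_Un closed_Int
        closed_Collect_le continuous_intros)
  have inj: "f = f'" if "(t, f) \<in> R" "(t, f') \<in> R" for t f f'
  proof (rule ccontr)
    assume "f \<noteq> f'"
    \<comment> \<open>A ball around a net point near \<open>f\<close> has \<open>f\<close> in its interior, which forces the answer to be
      positive, so \<open>f'\<close> lies in the closed ball and thus too close to \<open>f\<close>.\<close>
    then obtain n where n: "1 / Suc n < dist f f' / 2"
      using reals_Archimedean[of "dist f f' / 2"] by (auto simp: inverse_eq_divide)
    have "f \<in> K" using that by (auto simp: R_def)
    then obtain a where a: "a \<in> A n" "dist a f < 1 / Suc n"
      using A(2)[of n] by auto
    then have p: "(n, a) \<in> P"
      by (auto simp: P_def)
    from a that p have "dist a f' \<le> 1 / Suc n"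
      by (force simp: R_def)
    with a(2) n show False
      using dist_triangle3[of f f' a] by linarith
  qed
  have surj: "\<exists>t. (t, f) \<in> R" if "f \<in> K" for f
  proof -
    define b where "b m \<longleftrightarrow> (let p = from_nat_into P m in dist (snd p) f \<le> 1 / Suc (fst p))" for m
    have b: "b (idx p) \<longleftrightarrow> dist (snd p) f \<le> 1 / Suc (fst p)" if "p \<in> P" for p
      using that \<open>countable P\<close> by (simp add: b_def idx_def)
    have "(quaternary b, f) \<in> R"
      using that quaternary_bounds[of b] cos_quaternary[of b "idx p" for p] b
      by (force simp: R_def c_def split: if_splits)
    then show ?thesis ..
  qed
  \<comment> \<open>The first projection is injective on the compact set \<open>R\<close>, hence has a continuous inverse.\<close>
  define \<psi> where "\<psi> t = (THE q. q \<in> R \<and> fst q = t)" for t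
  have \<psi>: "\<psi> (fst q) = q" if "q \<in> R" for q
    unfolding \<psi>_def using that by (intro the_equality) (auto intro: inj simp: prod_eq_iff)
  have "continuous_on (fst ` R) \<psi>"
    using \<open>compact R\<close> \<psi> by (intro continuous_on_inv continuous_intros) auto
  then have "continuous_on (fst ` R) (snd \<circ> \<psi>)"
    by (auto simp: o_def intro!: continuous_intros)
  moreover have "compact (fst ` R)"
    using \<open>compact R\<close> by (intro compact_continuous_image continuous_intros)
  moreover have "fst ` R \<subseteq> {0..1}"
    by (auto simp: R_def)
  moreover have "(snd \<circ> \<psi>) ` fst ` R = K"
  proof -
    have "(snd \<circ> \<psi>) ` fst ` R = snd ` R"
      by (auto simp: image_image \<psi>)
    also have "\<dots> = K"
    proof
      show "snd ` R \<subseteq> K"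
        unfolding R_def by auto
      show "K \<subseteq> snd ` R"
        using surj by (metis image_eqI snd_conv subsetI)
    qed
    finally show ?thesis .
  qed
  ultimately show ?thesis
    using that by blast
qed

text \<open>Evaluation is jointly continuous because convergence in the supremum norm is uniform.\<close>

lemma continuous_on_bcontfun_eval:
  fixes F :: "'a::topological_space \<Rightarrow> ('b::metric_space \<Rightarrow>\<^sub>C 'c::metric_space)"
  assumes "continuous_on S F" "continuous_on S h"
  shows "continuous_on S (\<lambda>z. F z (h z))"
proof -
  have "((\<lambda>z. F z (h z)) \<longlongrightarrow> F w (h w)) (at w within S)" if "w \<in> S" for w
  proof (rule tendstoI)
    fix e :: real assume "e > 0"
    have "((\<lambda>z. F w (h z)) \<longlongrightarrow> F w (h w)) (at w within S)"
      using assms(2) that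
      by (intro continuous_on_tendsto_compose[of UNIV "apply_bcontfun (F w)"]
          continuous_on_apply_bcontfun) (auto simp: continuous_on_def)
    then have "\<forall>\<^sub>F z in at w within S. dist (F w (h z)) (F w (h w)) < e / 2"
      using \<open>e > 0\<close> by (intro tendstoD) auto
    moreover have "\<forall>\<^sub>F z in at w within S. dist (F z) (F w) < e / 2"
      using assms(1) that \<open>e > 0\<close> by (intro tendstoD) (auto simp: continuous_on_def)
    ultimately show "\<forall>\<^sub>F z in at w within S. dist (F z (h z)) (F w (h w)) < e"
    proof eventually_elim
      case (elim z)
      have "dist (F z (h z)) (F w (h z)) \<le> dist (F z) (F w)"
        by (rule dist_bounded)
      with elim show ?case
        using dist_triangle[of "F z (h z)" "F w (h w)" "F w (h z)"] by linarith
    qed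
  qed
  then show ?thesis
    by (simp add: continuous_on_def)
qed

lemma somewhere_differentiable_if_zero_on_segment:
  fixes f :: "'n::finite unit_cube \<Rightarrow>\<^sub>C real"
  assumes x: "point_of x \<in> box 0 1" and v: "v \<noteq> 0"
    and zero: "\<And>t. point_of x + t *\<^sub>R v \<in> cbox 0 1 \<Longrightarrow> f (to_cube (point_of x + t *\<^sub>R v)) = 0"
  shows "somewhere_differentiable f"
proof -
  have "((\<lambda>t. point_of x + t *\<^sub>R v) \<longlongrightarrow> point_of x + 0 *\<^sub>R v) (at 0)"
    by (intro tendsto_intros)
  then have "\<forall>\<^sub>F t in at 0. point_of x + t *\<^sub>R v \<in> box 0 1"
    using x by (intro topological_tendstoD[where S = "box 0 1"]) (auto simp: open_box)
  then have "\<forall>\<^sub>F t in at 0. (f (to_cube (point_of x + t *\<^sub>R v)) - f x) / t = 0"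
  proof eventually_elim
    case (elim t)
    have "f x = 0"
      using zero[of 0] x box_subset_cbox[of 0 "1 :: real ^ 'n"] by (auto simp: point_of_inverse)
    moreover have "f (to_cube (point_of x + t *\<^sub>R v)) = 0"
      using elim box_subset_cbox[of 0 "1 :: real ^ 'n"] by (intro zero) auto
    ultimately show ?case by simp
  qed
  then have "has_directional_derivative f x v 0"
    unfolding has_directional_derivative_def by (rule tendsto_eventually)
  with x v show ?thesis
    unfolding somewhere_differentiable_def nowhere_differentiable_def
    by (auto simp: interior_cbox)
qed

theorem proposition4p3:
  assumes "CARD('n::finite) > 1"
  shows "thick {f :: 'n unit_cube \<Rightarrow>\<^sub>C real. somewhere_differentiable f}"
  unfolding thick_def
proof (intro allI impI)
  fix K :: "('n unit_cube \<Rightarrow>\<^sub>C real) set"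
  assume "compact K"
  then obtain S and \<phi> :: "real \<Rightarrow> 'n unit_cube \<Rightarrow>\<^sub>C real"
    where S: "compact S" "S \<subseteq> {0..1}" "continuous_on S \<phi>" "\<phi> ` S = K"
    by (rule compact_metric_image_of_compact_reals)
  obtain i j :: 'n where "i \<noteq> j"
    using assms card_le_Suc0_iff_eq[of "UNIV :: 'n set"] by auto
  \<comment> \<open>\<open>C\<close> is the union of the slices reserved for the functions \<open>\<phi> t\<close>.\<close>
  define C where "C = cbox 0 1 \<inter> (\<lambda>z :: real ^ 'n. 3 * z $ j - 1) -` S"
  have "closed C"
    unfolding C_def using compact_imp_closed[OF S(1)]
    by (intro closed_Int closed_cbox continuous_closed_vimage continuous_intros) auto
  have "continuous_on C (\<lambda>z. \<phi> (3 * z $ j - 1))"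
    by (rule continuous_on_compose2[OF S(3)]) (auto simp: C_def intro!: continuous_intros)
  moreover have "continuous_on C to_cube"
    by (rule continuous_on_subset[OF continuous_on_to_cube]) (auto simp: C_def)
  ultimately have G0: "continuous_on C (\<lambda>z. - apply_bcontfun (\<phi> (3 * z $ j - 1)) (to_cube z))"
    by (intro continuous_on_minus continuous_on_bcontfun_eval)
  have "closedin (top_of_set UNIV) C"
    using \<open>closed C\<close> by simp
  then obtain G where G: "continuous_on UNIV G"
      "\<And>z. z \<in> C \<Longrightarrow> G z = - apply_bcontfun (\<phi> (3 * z $ j - 1)) (to_cube z)"
    using Dugundji[OF convex_UNIV UNIV_not_empty _ G0 subset_UNIV] by metis
  have "continuous_on UNIV (G \<circ> point_of)"
    using G(1) continuous_on_point_of
    by (intro continuous_on_compose) (auto intro: continuous_on_subset)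
  then have g: "apply_bcontfun (Bcontfun (G \<circ> point_of)) = G \<circ> point_of"
    by (intro Bcontfun_inverse) (simp add: continuous_on_unit_cube_bcontfun)
  show "\<exists>g. (\<lambda>f. f + g) ` K \<subseteq> {f. somewhere_differentiable f}"
  proof (intro exI[of _ "Bcontfun (G \<circ> point_of)"] image_subsetI CollectI)
    fix f assume "f \<in> K"
    then obtain t where t: "t \<in> S" "f = \<phi> t"
      using S(4) by blast
    \<comment> \<open>Since \<open>0 \<le> t \<le> 1\<close>, the coordinate \<open>(t + 1) / 3\<close> lies strictly inside the unit interval.\<close>
    define z :: "real ^ 'n" where "z = (\<chi> l. if l = j then (t + 1) / 3 else 1 / 2)"
    have z: "z \<in> box 0 1"
      using t S(2) by (auto simp: z_def mem_box_cart)
    then have "z \<in> cbox 0 1"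
      using box_subset_cbox by blast
    then have pz: "point_of (to_cube z) = z"
      by (rule to_cube_inverse)
    show "somewhere_differentiable (f + Bcontfun (G \<circ> point_of))"
    proof (rule somewhere_differentiable_if_zero_on_segment[where x = "to_cube z" and v = "axis i 1"],
        unfold pz)
      fix s
      let ?w = "z + s *\<^sub>R axis i 1"
      assume w: "?w \<in> cbox 0 1"
      have "3 * ?w $ j - 1 = t"
        using \<open>i \<noteq> j\<close> by (simp add: z_def axis_def field_simps)
      then show "(f + Bcontfun (G \<circ> point_of)) (to_cube ?w) = 0"
        using w t G(2)[of ?w] by (simp add: g C_def to_cube_inverse)
    qed (use z in \<open>auto simp: axis_eq_0_iff\<close>)
  qed
qed

end
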